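(* There exists a scalar second order ordinary differential equation $y''=F(x,y,y')$ which is not linearizable by a point transformation and which nevertheless admits a non-Cartan symmetry. In particular, admitting a non-Cartan symmetry does not characterize, among general (possibly nonlinear) systems of second order ordinary differential equations, those reducible by a point transformation to the trivial system $\mathbf y''=0$.
   Context: Here $F$ is a smooth function on some nonempty open set of the variables $(x,y,p)$, $p=y'$. A (Lie point) symmetry of $\Delta\equiv y''-F(x,y,y')=0$ is a smooth vector field $\mathbf v=\xi(x,y)\,\frac{\partial}{\partial x}+\phi(x,y)\,\frac{\partial}{\partial y}$ satisfying $\mathbf v^{(2)}(\Delta)\big|_{\Delta=0}=0$, where $\mathbf v^{(2)}$ is the second prolongation of $\mathbf v$. It is non-Cartan if $\xi$ depends explicitly on $y$ (i.e. $\partial\xi/\partial y$ is not identically zero). For systems with dependent variables $y_1,\dots,y_m$, a symmetry $\xi(x,\mathbf y)\,\frac{\partial}{\partial x}+\sum_j\phi_j(x,\mathbf y)\,\frac{\partial}{\partial y_j}$ is non-Cartan if $\xi$ depends explicitly on at least one $y_j$. An equation is linearizable by a point transformation if some (local) invertible smooth change of the independent and dependent variables transforms it into a linear ordinary differential equation; scalar equations are systems with $m=1$. *)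

theory Defs
  imports "HOL-Analysis.Analysis" "HOL-Analysis.Abstract_Euclidean_Space"
begin

text \<open>
  A system of \<open>m\<close> second order equations is studied in the jet coordinates
  \<open>z 0 = x\<close>, \<open>z j = y_j\<close>, \<open>z (m + j) = p_j = y_j'\<close>, \<open>z (2 * m + j) = q_j = y_j''\<close> with
  \<open>j \<in> {1..m}\<close>. Thus base points are points of \<open>Euclidean_space (m + 1)\<close>, first order jets
  points of \<open>Euclidean_space (2 * m + 1)\<close> and second order jets points of
  \<open>Euclidean_space (3 * m + 1)\<close>; all of these are sequences that vanish from the
  given index on. Components indexed by \<open>j\<close> are relevant for \<open>j \<in> {1..m}\<close> only.
\<close>

definition trunc :: "nat \<Rightarrow> (nat \<Rightarrow> real) \<Rightarrow> nat \<Rightarrow> real" where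
  "trunc n z = (\<lambda>i. if i < n then z i else 0)"

definition pd :: "nat \<Rightarrow> ((nat \<Rightarrow> real) \<Rightarrow> real) \<Rightarrow> (nat \<Rightarrow> real) \<Rightarrow> real" where
  "pd i f z = deriv (\<lambda>t. f (z(i := t))) (z i)"

primrec Ck_on :: "nat \<Rightarrow> nat \<Rightarrow> (nat \<Rightarrow> real) set \<Rightarrow> ((nat \<Rightarrow> real) \<Rightarrow> real) \<Rightarrow> bool" where
  "Ck_on 0 n U f \<longleftrightarrow>
     continuous_map (subtopology (Euclidean_space n) U) euclideanreal f"
| "Ck_on (Suc k) n U f \<longleftrightarrow>
     continuous_map (subtopology (Euclidean_space n) U) euclideanreal f \<and>
     (\<forall>i<n. (\<forall>z\<in>U. (\<lambda>t. f (z(i := t))) differentiable (at (z i))) \<and> Ck_on k n U (pd i f))"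

text \<open>Meaningful for \<open>U\<close> open in \<open>Euclidean_space n\<close>.\<close>

definition smooth_on :: "nat \<Rightarrow> (nat \<Rightarrow> real) set \<Rightarrow> ((nat \<Rightarrow> real) \<Rightarrow> real) \<Rightarrow> bool" where
  "smooth_on n U f \<longleftrightarrow> (\<forall>k. Ck_on k n U f)"


definition second_order_system ::
    "nat \<Rightarrow> (nat \<Rightarrow> real) set \<Rightarrow> (nat \<Rightarrow> (nat \<Rightarrow> real) \<Rightarrow> real) \<Rightarrow> bool" where
  "second_order_system m \<Omega> F \<longleftrightarrow>
     1 \<le> m \<and> openin (Euclidean_space (2 * m + 1)) \<Omega> \<and> \<Omega> \<noteq> {} \<and>
     (\<forall>j\<in>{1..m}. smooth_on (2 * m + 1) \<Omega> (F j))"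

definition Delta ::
    "nat \<Rightarrow> (nat \<Rightarrow> (nat \<Rightarrow> real) \<Rightarrow> real) \<Rightarrow> nat \<Rightarrow> (nat \<Rightarrow> real) \<Rightarrow> real" where
  "Delta m F j z = z (2 * m + j) - F j (trunc (2 * m + 1) z)"

definition on_equation ::
    "nat \<Rightarrow> (nat \<Rightarrow> real) set \<Rightarrow> (nat \<Rightarrow> (nat \<Rightarrow> real) \<Rightarrow> real) \<Rightarrow> (nat \<Rightarrow> real) \<Rightarrow> bool" where
  "on_equation m \<Omega> F z \<longleftrightarrow>
     z \<in> topspace (Euclidean_space (3 * m + 1)) \<and> trunc (2 * m + 1) z \<in> \<Omega> \<and>
     (\<forall>j\<in>{1..m}. Delta m F j z = 0)"

text \<open>Total derivative with respect to \<open>x\<close> of a function of first order jets.\<close>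

definition total_deriv :: "nat \<Rightarrow> ((nat \<Rightarrow> real) \<Rightarrow> real) \<Rightarrow> (nat \<Rightarrow> real) \<Rightarrow> real" where
  "total_deriv m g z =
     pd 0 g z + (\<Sum>j=1..m. z (m + j) * pd j g z) + (\<Sum>j=1..m. z (2 * m + j) * pd (m + j) g z)"

text \<open>
  A function on the base is regarded as a function of jets by composing it with the
  projection to the base, so that its derivatives in the directions \<open>p_j\<close> vanish.
\<close>

definition lift :: "nat \<Rightarrow> ((nat \<Rightarrow> real) \<Rightarrow> real) \<Rightarrow> (nat \<Rightarrow> real) \<Rightarrow> real" where
  "lift m f = (\<lambda>z. f (trunc (m + 1) z))"

definition prolong_coeff1 ::
    "nat \<Rightarrow> ((nat \<Rightarrow> real) \<Rightarrow> real) \<Rightarrow> (nat \<Rightarrow> (nat \<Rightarrow> real) \<Rightarrow> real) \<Rightarrow>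
     nat \<Rightarrow> (nat \<Rightarrow> real) \<Rightarrow> real" where
  "prolong_coeff1 m \<xi> \<phi> j z =
     total_deriv m (lift m (\<phi> j)) z - z (m + j) * total_deriv m (lift m \<xi>) z"

definition prolong_coeff2 ::
    "nat \<Rightarrow> ((nat \<Rightarrow> real) \<Rightarrow> real) \<Rightarrow> (nat \<Rightarrow> (nat \<Rightarrow> real) \<Rightarrow> real) \<Rightarrow>
     nat \<Rightarrow> (nat \<Rightarrow> real) \<Rightarrow> real" where
  "prolong_coeff2 m \<xi> \<phi> j z =
     total_deriv m (prolong_coeff1 m \<xi> \<phi> j) z - z (2 * m + j) * total_deriv m (lift m \<xi>) z"

text \<open>The second prolongation of the vector field with components \<open>\<xi>\<close>, \<open>\<phi> j\<close>, acting on \<open>G\<close>.\<close>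

definition prolong2 ::
    "nat \<Rightarrow> ((nat \<Rightarrow> real) \<Rightarrow> real) \<Rightarrow> (nat \<Rightarrow> (nat \<Rightarrow> real) \<Rightarrow> real) \<Rightarrow>
     ((nat \<Rightarrow> real) \<Rightarrow> real) \<Rightarrow> (nat \<Rightarrow> real) \<Rightarrow> real" where
  "prolong2 m \<xi> \<phi> G z =
     lift m \<xi> z * pd 0 G z +
     (\<Sum>j=1..m. lift m (\<phi> j) z * pd j G z +
               prolong_coeff1 m \<xi> \<phi> j z * pd (m + j) G z +
               prolong_coeff2 m \<xi> \<phi> j z * pd (2 * m + j) G z)"

definition symmetry ::
    "nat \<Rightarrow> (nat \<Rightarrow> real) set \<Rightarrow> (nat \<Rightarrow> (nat \<Rightarrow> real) \<Rightarrow> real) \<Rightarrow>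
     ((nat \<Rightarrow> real) \<Rightarrow> real) \<Rightarrow> (nat \<Rightarrow> (nat \<Rightarrow> real) \<Rightarrow> real) \<Rightarrow> bool" where
  "symmetry m \<Omega> F \<xi> \<phi> \<longleftrightarrow>
     smooth_on (m + 1) (trunc (m + 1) ` \<Omega>) \<xi> \<and>
     (\<forall>j\<in>{1..m}. smooth_on (m + 1) (trunc (m + 1) ` \<Omega>) (\<phi> j)) \<and>
     (\<forall>z. on_equation m \<Omega> F z \<longrightarrow> (\<forall>j\<in>{1..m}. prolong2 m \<xi> \<phi> (Delta m F j) z = 0))"

definition non_Cartan :: "nat \<Rightarrow> (nat \<Rightarrow> real) set \<Rightarrow> ((nat \<Rightarrow> real) \<Rightarrow> real) \<Rightarrow> bool" where
  "non_Cartan m B \<xi> \<longleftrightarrow> (\<exists>j\<in>{1..m}. \<exists>z\<in>B. pd j \<xi> z \<noteq> 0)"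

definition admits_non_Cartan_symmetry ::
    "nat \<Rightarrow> (nat \<Rightarrow> real) set \<Rightarrow> (nat \<Rightarrow> (nat \<Rightarrow> real) \<Rightarrow> real) \<Rightarrow> bool" where
  "admits_non_Cartan_symmetry m \<Omega> F \<longleftrightarrow>
     (\<exists>\<xi> \<phi>. symmetry m \<Omega> F \<xi> \<phi> \<and> non_Cartan m (trunc (m + 1) ` \<Omega>) \<xi>)"


text \<open>
  An invertible smooth change of variables, defined on the open set \<open>W\<close>: component \<open>0\<close> of
  \<open>\<Phi>\<close> is the new independent variable, components \<open>1..m\<close> are the new dependent variables.
\<close>

definition point_transformation ::
    "nat \<Rightarrow> (nat \<Rightarrow> real) set \<Rightarrow> ((nat \<Rightarrow> real) \<Rightarrow> nat \<Rightarrow> real) \<Rightarrow> bool" where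
  "point_transformation m W \<Phi> \<longleftrightarrow>
     openin (Euclidean_space (m + 1)) W \<and> openin (Euclidean_space (m + 1)) (\<Phi> ` W) \<and>
     inj_on \<Phi> W \<and>
     (\<forall>i\<le>m. smooth_on (m + 1) W (\<lambda>z. \<Phi> z i)) \<and>
     (\<forall>i\<le>m. smooth_on (m + 1) (\<Phi> ` W) (\<lambda>w. inv_into W \<Phi> w i))"

text \<open>
  Transformed first derivatives \<open>dY_j/dX = D Y_j / D X\<close> and second derivatives
  \<open>d\<^sup>2Y_j/dX\<^sup>2 = D (dY_j/dX) / D X\<close>; they are defined where \<open>D X \<noteq> 0\<close>.
\<close>

definition new_deriv1 ::
    "nat \<Rightarrow> ((nat \<Rightarrow> real) \<Rightarrow> nat \<Rightarrow> real) \<Rightarrow> nat \<Rightarrow> (nat \<Rightarrow> real) \<Rightarrow> real" where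
  "new_deriv1 m \<Phi> j z =
     total_deriv m (lift m (\<lambda>b. \<Phi> b j)) z / total_deriv m (lift m (\<lambda>b. \<Phi> b 0)) z"

definition new_deriv2 ::
    "nat \<Rightarrow> ((nat \<Rightarrow> real) \<Rightarrow> nat \<Rightarrow> real) \<Rightarrow> nat \<Rightarrow> (nat \<Rightarrow> real) \<Rightarrow> real" where
  "new_deriv2 m \<Phi> j z =
     total_deriv m (new_deriv1 m \<Phi> j) z / total_deriv m (lift m (\<lambda>b. \<Phi> b 0)) z"

definition prolong_map ::
    "nat \<Rightarrow> ((nat \<Rightarrow> real) \<Rightarrow> nat \<Rightarrow> real) \<Rightarrow> (nat \<Rightarrow> real) \<Rightarrow> nat \<Rightarrow> real" where
  "prolong_map m \<Phi> z =
     (\<lambda>i. if i \<le> m then \<Phi> (trunc (m + 1) z) i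
          else if i \<le> 2 * m then new_deriv1 m \<Phi> (i - m) z
          else if i \<le> 3 * m then new_deriv2 m \<Phi> (i - 2 * m) z
          else 0)"

text \<open>
  The transformation is local: it relates the two systems over some nonempty open set \<open>U\<close> of
  first order jets, on which \<open>D X \<noteq> 0\<close>.
\<close>

definition point_transforms_into ::
    "nat \<Rightarrow> (nat \<Rightarrow> real) set \<Rightarrow> (nat \<Rightarrow> (nat \<Rightarrow> real) \<Rightarrow> real) \<Rightarrow>
     (nat \<Rightarrow> real) set \<Rightarrow> (nat \<Rightarrow> (nat \<Rightarrow> real) \<Rightarrow> real) \<Rightarrow> bool" where
  "point_transforms_into m \<Omega> F \<Omega>' G \<longleftrightarrow>
     (\<exists>W \<Phi> U. point_transformation m W \<Phi> \<and>
        openin (Euclidean_space (2 * m + 1)) U \<and> U \<noteq> {} \<and> U \<subseteq> \<Omega> \<and> trunc (m + 1) ` U \<subseteq> W \<and>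
        (\<forall>z\<in>topspace (Euclidean_space (3 * m + 1)). trunc (2 * m + 1) z \<in> U \<longrightarrow>
           total_deriv m (lift m (\<lambda>b. \<Phi> b 0)) z \<noteq> 0 \<and>
           trunc (2 * m + 1) (prolong_map m \<Phi> z) \<in> \<Omega>' \<and>
           (on_equation m \<Omega> F z \<longleftrightarrow> on_equation m \<Omega>' G (prolong_map m \<Phi> z))))"

text \<open>
  \<open>Y'' = A(X) Y' + B(X) Y + C(X)\<close> with \<open>X\<close> in an open set \<open>I\<close>; smoothness of the coefficients
  on \<open>I\<close> is the smoothness of \<open>G\<close> on \<open>\<Omega>\<close>.
\<close>

definition linear_system ::
    "nat \<Rightarrow> (nat \<Rightarrow> real) set \<Rightarrow> (nat \<Rightarrow> (nat \<Rightarrow> real) \<Rightarrow> real) \<Rightarrow> bool" where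
  "linear_system m \<Omega> G \<longleftrightarrow>
     second_order_system m \<Omega> G \<and>
     (\<exists>I A B C. open I \<and> \<Omega> = {z \<in> topspace (Euclidean_space (2 * m + 1)). z 0 \<in> I} \<and>
        (\<forall>z\<in>\<Omega>. \<forall>j\<in>{1..m}.
           G j z = (\<Sum>k=1..m. A j k (z 0) * z (m + k)) + (\<Sum>k=1..m. B j k (z 0) * z k) + C j (z 0)))"

definition linearizable ::
    "nat \<Rightarrow> (nat \<Rightarrow> real) set \<Rightarrow> (nat \<Rightarrow> (nat \<Rightarrow> real) \<Rightarrow> real) \<Rightarrow> bool" where
  "linearizable m \<Omega> F \<longleftrightarrow>
     (\<exists>\<Omega>' G. linear_system m \<Omega>' G \<and> point_transforms_into m \<Omega> F \<Omega>' G)"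

definition reducible_to_trivial ::
    "nat \<Rightarrow> (nat \<Rightarrow> real) set \<Rightarrow> (nat \<Rightarrow> (nat \<Rightarrow> real) \<Rightarrow> real) \<Rightarrow> bool" where
  "reducible_to_trivial m \<Omega> F \<longleftrightarrow>
     point_transforms_into m \<Omega> F (topspace (Euclidean_space (2 * m + 1))) (\<lambda>j z. 0)"

end

(*
  The equation y'' = (p - 1)^4 / p on p > 0 admits the non-Cartan symmetry
  (2 x + y) d/dx + 3 y d/dy. A point transformation to a linear equation would, over each fixed
  base point (x, y), give J F(p) = P(p) for a nonzero constant J and a polynomial P, on an open
  interval of p; then J (p - 1)^4 = p P(p) identically, and p = 0 yields J = 0.
  The trivial system is linear, so the equation is not reducible to it either.
*)
theory Submission
  imports Defs
begin

section \<open>Partial derivatives and smoothness along coordinate lines\<close>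

lemma topspace_Euclidean_space_iff:
  "z \<in> topspace (Euclidean_space n) \<longleftrightarrow> (\<forall>i\<ge>n. z i = 0)"
  by (simp add: Euclidean_space_def)

lemma continuous_map_coordinate:
  "continuous_map (subtopology (Euclidean_space n) U) euclideanreal (\<lambda>z. z i)"
  unfolding Euclidean_space_def
  by (intro continuous_map_from_subtopology continuous_map_product_projection) auto

lemma continuous_map_coordinate_line:
  assumes "z \<in> topspace (Euclidean_space n)" "i < n"
  shows "continuous_map euclideanreal (Euclidean_space n) (\<lambda>t. z(i := t))"
  using assms unfolding Euclidean_space_def
  by (auto simp: continuous_map_in_subtopology continuous_map_componentwise_UNIV)

text \<open>Reduces openness in \<open>Euclidean_space n\<close> to openness in the reals along one
  coordinate. It makes \<open>pd\<close> a local notion and later supplies the open set of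
  directions p over a fixed base point.\<close>

lemma open_coordinate_line:
  assumes "openin (Euclidean_space n) U" "z \<in> topspace (Euclidean_space n)" "i < n"
  shows "open {t. z(i := t) \<in> U}"
  using openin_continuous_map_preimage[OF continuous_map_coordinate_line[OF assms(2,3)] assms(1)]
  by simp

lemma eventually_coordinate_line:
  assumes "openin (Euclidean_space n) U" "z \<in> U" "i < n"
  shows "eventually (\<lambda>t. z(i := t) \<in> U) (nhds (z i))"
proof -
  have "z \<in> topspace (Euclidean_space n)"
    using assms openin_subset by blast
  from open_coordinate_line[OF assms(1) this assms(3)] show ?thesis
    using assms(2) by (auto simp: eventually_nhds intro!: exI[of _ "{t. z(i := t) \<in> U}"])
qed

lemma pd_eqI:
  "((\<lambda>t. f (z(i := t))) has_field_derivative D) (at (z i)) \<Longrightarrow> pd i f z = D"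
  by (simp add: pd_def DERIV_imp_deriv)

lemma pd_cong:
  assumes "openin (Euclidean_space n) U" "z \<in> U" "i < n" "\<And>w. w \<in> U \<Longrightarrow> f w = g w"
  shows "pd i f z = pd i g z"
  unfolding pd_def
  by (rule deriv_cong_ev[OF eventually_mono[OF eventually_coordinate_line[OF assms(1-3)]]])
     (use assms in auto)

text \<open>On an open set, \<open>pd\<close> at a point depends only on values inside the set, so
  agreement passes to all iterated derivatives. Closed forms that hold only where a denominator is
  nonzero can thus replace a function.\<close>

lemma Ck_on_cong:
  assumes "openin (Euclidean_space n) U" "\<And>w. w \<in> U \<Longrightarrow> f w = g w" "Ck_on k n U f"
  shows "Ck_on k n U g"
  using assms(2,3)
proof (induction k arbitrary: f g)
  case 0
  then show ?case
    by (auto elim!: continuous_map_eq)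
next
  case (Suc k)
  have cont: "continuous_map (subtopology (Euclidean_space n) U) euclideanreal g"
    using Suc.prems by (auto elim!: continuous_map_eq)
  have "(\<lambda>t. g (z(i := t))) differentiable (at (z i))" if iz: "i < n" "z \<in> U" for i z
  proof -
    obtain D where D: "((\<lambda>t. f (z(i := t))) has_field_derivative D) (at (z i))"
      using Suc.prems(2) iz by (auto simp: real_differentiable_def)
    have "eventually (\<lambda>t. f (z(i := t)) = g (z(i := t))) (nhds (z i))"
      using eventually_coordinate_line[OF assms(1) iz(2,1)] Suc.prems(1)
      by (auto elim!: eventually_mono)
    from DERIV_cong_ev[OF refl this refl] D
    show ?thesis
      by (force simp: real_differentiable_def Suc.prems(1))
  qed
  moreover have "Ck_on k n U (pd i g)" if "i < n" for i
    using Suc.prems(2) that pd_cong[OF assms(1) _ that Suc.prems(1)]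
    by (intro Suc.IH[of "pd i f" "pd i g"]) auto
  ultimately show ?case
    using cont by simp
qed

text \<open>A family of continuous functions closed under partial differentiation consists of smooth
  functions: each induction step stays in the family, so no higher derivative is ever
  computed.\<close>

lemma smooth_on_family:
  assumes "openin (Euclidean_space n) U"
    and "\<And>f. f \<in> S \<Longrightarrow> continuous_map (subtopology (Euclidean_space n) U) euclideanreal f"
    and "\<And>f i. f \<in> S \<Longrightarrow> i < n \<Longrightarrow>
      \<exists>g\<in>S. \<forall>z\<in>U. ((\<lambda>t. f (z(i := t))) has_field_derivative g z) (at (z i))"
    and "f \<in> S"
  shows "smooth_on n U f"
proof -
  have "Ck_on k n U f" if "f \<in> S" for k f
    using that
  proof (induction k arbitrary: f)
    case 0
    then show ?case using assms(2) by simp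
  next
    case (Suc k)
    have "(\<forall>z\<in>U. (\<lambda>t. f (z(i := t))) differentiable (at (z i))) \<and> Ck_on k n U (pd i f)"
      if i: "i < n" for i
    proof -
      obtain g where g: "g \<in> S"
        "\<And>z. z \<in> U \<Longrightarrow> ((\<lambda>t. f (z(i := t))) has_field_derivative g z) (at (z i))"
        using assms(3)[OF Suc.prems i] by blast
      have "Ck_on k n U (pd i f)"
        by (rule Ck_on_cong[OF assms(1) _ Suc.IH[OF g(1)]])
           (use g(2) pd_eqI in force)
      then show ?thesis
        using g(2) by (auto simp: real_differentiable_def)
    qed
    then show ?case
      using assms(2)[OF Suc.prems] by simp
  qed
  then show ?thesis
    using assms(4) by (simp add: smooth_on_def)
qed

lemma smooth_on_const: "smooth_on n U (\<lambda>z. c)"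
proof -
  have "pd i (\<lambda>z. c) = (\<lambda>z. 0)" for i c
    by (simp add: pd_def fun_eq_iff)
  then have "Ck_on k n U (\<lambda>z. c)" for k
    by (induction k arbitrary: c) simp_all
  then show ?thesis by (simp add: smooth_on_def)
qed

lemma has_field_derivative_fun_upd:
  "((\<lambda>t. (z(i := t)) j) has_field_derivative (if i = j then 1 else 0)) (at (x :: real))"
  by auto

lemma smooth_on_linear2:
  "smooth_on n U (\<lambda>z. a * z i + b * z j)"
proof -
  have deriv: "((\<lambda>t. a * (z(l := t)) i + b * (z(l := t)) j) has_field_derivative
      a * (if l = i then 1 else 0) + b * (if l = j then 1 else 0)) (at (x :: real))" for z l x
    by (intro DERIV_add DERIV_cmult has_field_derivative_fun_upd)
  have pd: "pd l (\<lambda>z. a * z i + b * z j) =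
      (\<lambda>z. a * (if l = i then 1 else 0) + b * (if l = j then 1 else 0))" for l
    using DERIV_imp_deriv[OF deriv] by (simp add: pd_def fun_eq_iff)
  have "Ck_on k n U (\<lambda>z. a * z i + b * z j)" for k
  proof (cases k)
    case 0
    then show ?thesis
      by (auto intro!: continuous_intros continuous_map_coordinate)
  next
    case (Suc k)
    have "continuous_map (subtopology (Euclidean_space n) U) euclideanreal (\<lambda>z. a * z i + b * z j)"
      by (auto intro!: continuous_intros continuous_map_coordinate)
    moreover have "(\<lambda>t. a * (z(l := t)) i + b * (z(l := t)) j) differentiable (at x)" for z l x
      using deriv real_differentiable_def by blast
    ultimately show ?thesis
      unfolding Suc using smooth_on_const by (simp add: pd smooth_on_def del: fun_upd_apply)
  qed
  then show ?thesis by (simp add: smooth_on_def)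
qed

section \<open>The example equation and its non-Cartan symmetry\<close>

text \<open>
  For a linear vector field \<open>(a x + b y) \<partial>\<^sub>x + (c x + d y) \<partial>\<^sub>y\<close> the equations \<open>y'' = F(p)\<close> that admit it
  satisfy \<open>F'/F = (d - 2 a - 3 b p) / (c + (d - a) p - b p\<^sup>2)\<close>; with \<open>(a, b, c, d) = (2, 1, 0, 3)\<close>
  a solution is \<open>F = (p - 1)\<^sup>4 / p\<close>.
\<close>

definition jet_domain :: "(nat \<Rightarrow> real) set" where
  "jet_domain = {z \<in> topspace (Euclidean_space 3). z 2 > 0}"

definition example_rhs :: "nat \<Rightarrow> (nat \<Rightarrow> real) \<Rightarrow> real" where
  "example_rhs j z = (z 2 - 1) ^ 4 / z 2"

lemma openin_jet_domain: "openin (Euclidean_space 3) jet_domain"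
proof -
  have "continuous_map (Euclidean_space 3) euclideanreal (\<lambda>z. z 2)"
    using continuous_map_coordinate[of 3 "topspace (Euclidean_space 3)" 2] by simp
  from openin_continuous_map_preimage[OF this, of "{0<..}"] show ?thesis
    by (simp add: jet_domain_def)
qed

text \<open>Sums of a polynomial in t and a polynomial in 1/t are closed under differentiation,
  which is what \<open>smooth_on_family\<close> asks for.\<close>

lemma smooth_on_poly_inverse:
  assumes "openin (Euclidean_space n) U" "\<And>z. z \<in> U \<Longrightarrow> z j \<noteq> 0"
  shows "smooth_on n U (\<lambda>z. poly P (z j) + poly Q (inverse (z j)))"
proof (rule smooth_on_family[OF assms(1)])
  define S :: "((nat \<Rightarrow> real) \<Rightarrow> real) set"
    where "S = range (\<lambda>(P, Q) z. poly P (z j) + poly Q (inverse (z j)))"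
  show "(\<lambda>z. poly P (z j) + poly Q (inverse (z j))) \<in> S"
    unfolding S_def by (rule image_eqI[of _ _ "(P, Q)"]) auto
  show "continuous_map (subtopology (Euclidean_space n) U) euclideanreal f" if fS: "f \<in> S" for f
  proof -
    obtain P Q where f: "f = (\<lambda>z. poly P (z j) + poly Q (inverse (z j)))"
      using fS by (auto simp: S_def)
    have "continuous_map (subtopology (Euclidean_space n) U) (top_of_set (- {0})) (\<lambda>z. z j)"
      using assms(2) by (auto simp: continuous_map_in_subtopology continuous_map_coordinate)
    moreover have "continuous_map (top_of_set (- {0})) euclideanreal
        (\<lambda>t. poly P t + poly Q (inverse t))"
      by (auto intro!: continuous_intros)
    ultimately show ?thesis
      unfolding f by (rule continuous_map_compose[unfolded o_def])
  qed
  show "\<exists>g\<in>S. \<forall>z\<in>U. ((\<lambda>t. f (z(i := t))) has_field_derivative g z) (at (z i))"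
    if fS: "f \<in> S" for f i
  proof -
    obtain P Q where f: "f = (\<lambda>z. poly P (z j) + poly Q (inverse (z j)))"
      using fS by (auto simp: S_def)
    show ?thesis
    proof (cases "i = j")
      case False
      have "(\<lambda>z. 0) \<in> S"
        unfolding S_def by (rule image_eqI[of _ _ "(0, 0)"]) auto
      moreover have "((\<lambda>t. f (z(i := t))) has_field_derivative 0) (at (z i))" for z
        using False by (simp add: f)
      ultimately show ?thesis by (intro bexI[of _ "\<lambda>z. 0"]) auto
    next
      case True
      \<comment> \<open>Chain rule with s = 1/t: the derivative of Q(s) in t is -s^2 Q'(s), again a
        polynomial in s.\<close>
      let ?Q = "- ([:0, 0, 1:] * pderiv Q)"
      have "((\<lambda>t. f (z(i := t))) has_field_derivative
          poly (pderiv P) (z j) + poly ?Q (inverse (z j))) (at (z i))" if "z \<in> U" for z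
        using assms(2)[OF that] True unfolding f
        by (auto intro!: derivative_eq_intros DERIV_chain2[OF poly_DERIV] simp: power2_eq_square)
      moreover have "(\<lambda>z. poly (pderiv P) (z j) + poly ?Q (inverse (z j))) \<in> S"
        unfolding S_def by (rule image_eqI[of _ _ "(pderiv P, ?Q)"]) auto
      ultimately show ?thesis
        by (intro bexI[of _ "\<lambda>z. poly (pderiv P) (z j) + poly ?Q (inverse (z j))"]) auto
    qed
  qed
qed

lemma second_order_system_example: "second_order_system 1 jet_domain example_rhs"
proof -
  have "(\<lambda>i. if i = 2 then 1 else 0) \<in> jet_domain"
    by (simp add: jet_domain_def topspace_Euclidean_space_iff)
  moreover have "smooth_on 3 jet_domain (example_rhs j)" for j
  proof -
    have nz: "z 2 \<noteq> 0" if "z \<in> jet_domain" for z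
      using that by (simp add: jet_domain_def)
    \<comment> \<open>Division with remainder: (t - 1)^4 / t = t^3 - 4 t^2 + 6 t - 4 + 1/t.\<close>
    have eq: "poly [:-4, 6, -4, 1:] (z 2) + poly [:0, 1:] (inverse (z 2)) = example_rhs j z"
      if "z \<in> jet_domain" for z
    proof -
      have "(t - 1) ^ 4 = t * (- 4 + t * (6 + t * (- 4 + t))) + 1" for t :: real
        by algebra
      then show ?thesis
        using nz[OF that] by (simp add: example_rhs_def add_divide_distrib inverse_eq_divide)
    qed
    have "smooth_on 3 jet_domain
        (\<lambda>z. poly [:-4, 6, -4, 1:] (z 2) + poly [:0, 1:] (inverse (z 2)))"
      by (rule smooth_on_poly_inverse[OF openin_jet_domain nz])
    then show ?thesis
      unfolding smooth_on_def using Ck_on_cong[OF openin_jet_domain eq] by simp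
  qed
  ultimately show ?thesis
    using openin_jet_domain by (auto simp: second_order_system_def)
qed

text \<open>For \<open>m = 1\<close> the coordinates 0, 1, 2, 3 are x, y, p and q = y''.\<close>

lemma total_deriv_1:
  "total_deriv 1 g z = pd 0 g z + z 2 * pd 1 g z + z 3 * pd 2 g z"
  by (simp add: total_deriv_def numeral_2_eq_2 numeral_3_eq_3)

lemma trunc_fun_upd:
  "trunc n (z(i := t)) = (if i < n then (trunc n z)(i := t) else trunc n z)"
  by (auto simp: trunc_def fun_eq_iff)

lemma trunc_apply: "i < n \<Longrightarrow> trunc n z i = z i"
  by (simp add: trunc_def)

lemma pd_lift:
  "pd i (lift m f) z = (if i \<le> m then pd i f (trunc (m + 1) z) else 0)"
  by (auto simp: pd_def lift_def trunc_fun_upd trunc_apply)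

text \<open>A lifted function is constant in the direction p, so the term with q drops out.\<close>

lemma total_deriv_lift_1:
  "total_deriv 1 (lift 1 f) z = pd 0 f (trunc 2 z) + z 2 * pd 1 f (trunc 2 z)"
  unfolding total_deriv_1 pd_lift by (simp add: numeral_2_eq_2)

text \<open>The factor 1 here and the zero summand in \<open>example_phi\<close> give both
  coefficients the literal shape of \<open>smooth_on_linear2\<close>.\<close>

definition example_xi :: "(nat \<Rightarrow> real) \<Rightarrow> real" where
  "example_xi b = 2 * b 0 + 1 * b 1"

definition example_phi :: "nat \<Rightarrow> (nat \<Rightarrow> real) \<Rightarrow> real" where
  "example_phi j b = 3 * b 1 + 0 * b 0"

lemma pd_example:
  "pd 0 example_xi b = 2" "pd 1 example_xi b = 1"
  "pd 0 (example_phi j) b = 0" "pd 1 (example_phi j) b = 3"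
  unfolding example_xi_def example_phi_def
  by (rule pd_eqI; auto intro!: derivative_eq_intros)+

text \<open>The first coefficient is 3 p - p (2 + p); the second is q (1 - 2 p) - q (2 + p).\<close>

lemma prolong_coeff_example:
  "prolong_coeff1 1 example_xi example_phi 1 = (\<lambda>z. z 2 - z 2 ^ 2)"
  "prolong_coeff2 1 example_xi example_phi 1 z = - (1 + 3 * z 2) * z 3"
proof -
  show *: "prolong_coeff1 1 example_xi example_phi 1 = (\<lambda>z. z 2 - z 2 ^ 2)"
    unfolding prolong_coeff1_def total_deriv_lift_1 pd_example
    by (auto simp: fun_eq_iff numeral_2_eq_2[symmetric] algebra_simps power2_eq_square)
  have pds: "pd 0 (\<lambda>z. z 2 - z 2 ^ 2) z = 0" "pd 1 (\<lambda>z. z 2 - z 2 ^ 2) z = 0"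
    "pd 2 (\<lambda>z. z 2 - z 2 ^ 2) z = 1 - 2 * z 2"
    by (rule pd_eqI; auto intro!: derivative_eq_intros)+
  show "prolong_coeff2 1 example_xi example_phi 1 z = - (1 + 3 * z 2) * z 3"
    unfolding prolong_coeff2_def * total_deriv_lift_1 total_deriv_1[of "\<lambda>z. z 2 - z 2 ^ 2"] pd_example pds
    by (simp add: algebra_simps numeral_3_eq_3[symmetric] numeral_2_eq_2[symmetric])
qed

lemma Delta_example:
  "Delta 1 example_rhs 1 = (\<lambda>z. z 3 - (z 2 - 1) ^ 4 / z 2)"
  by (simp add: fun_eq_iff Delta_def example_rhs_def trunc_apply numeral_3_eq_3[symmetric])

lemma pd_Delta_example:
  assumes "z 2 \<noteq> 0"
  shows "pd 0 (Delta 1 example_rhs 1) z = 0" "pd 1 (Delta 1 example_rhs 1) z = 0"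
    "pd 2 (Delta 1 example_rhs 1) z = - ((4 * (z 2 - 1) ^ 3 * z 2 - (z 2 - 1) ^ 4) / (z 2 * z 2))"
    "pd 3 (Delta 1 example_rhs 1) z = 1"
proof -
  show "pd 2 (Delta 1 example_rhs 1) z = - ((4 * (z 2 - 1) ^ 3 * z 2 - (z 2 - 1) ^ 4) / (z 2 * z 2))"
    using assms unfolding Delta_example by (intro pd_eqI) (auto intro!: derivative_eq_intros)
  show "pd 0 (Delta 1 example_rhs 1) z = 0" "pd 1 (Delta 1 example_rhs 1) z = 0"
    "pd 3 (Delta 1 example_rhs 1) z = 1"
    unfolding Delta_example by (rule pd_eqI; auto intro!: derivative_eq_intros)+
qed

text \<open>On the equation, with a = p - 1, the prolonged field applied to \<open>Delta\<close>
  factors as a^4 / p times 4 p - a - (1 + 3 p), and the second factor is p - 1 - a = 0.\<close>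

lemma symmetry_example: "symmetry 1 jet_domain example_rhs example_xi example_phi"
proof -
  have "smooth_on 2 V example_xi" "smooth_on 2 V (example_phi j)" for V j
    unfolding example_xi_def[abs_def] example_phi_def[abs_def] by (rule smooth_on_linear2)+
  moreover have "prolong2 1 example_xi example_phi (Delta 1 example_rhs 1) z = 0"
    if on: "on_equation 1 jet_domain example_rhs z" for z
  proof -
    have nz: "z 2 \<noteq> 0" and q: "z 3 = (z 2 - 1) ^ 4 / z 2"
      using on by (auto simp: on_equation_def jet_domain_def trunc_apply Delta_example[unfolded One_nat_def])
    define p a where "p = z 2" and "a = z 2 - 1"
    have "prolong2 1 example_xi example_phi (Delta 1 example_rhs 1) z =
      prolong_coeff1 1 example_xi example_phi 1 z * pd 2 (Delta 1 example_rhs 1) z +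
      prolong_coeff2 1 example_xi example_phi 1 z"
      using pd_Delta_example[of z, OF nz]
      by (simp add: prolong2_def numeral_2_eq_2[symmetric] numeral_3_eq_3[symmetric])
    also have "\<dots> = - (p * a) * - ((4 * a ^ 3 * p - a ^ 4) / (p * p)) + - (1 + 3 * p) * (a ^ 4 / p)"
      unfolding prolong_coeff_example pd_Delta_example(3)[of z, OF nz] q p_def a_def
      by (simp add: algebra_simps power2_eq_square)
    also have "\<dots> = a ^ 4 / p * (4 * p - a - (1 + 3 * p))"
      using nz by (simp add: p_def[symmetric] field_simps power3_eq_cube power4_eq_xxxx)
    also have "\<dots> = 0"
      by (simp add: p_def a_def)
    finally show ?thesis .
  qed
  ultimately show ?thesis
    by (simp add: symmetry_def numeral_2_eq_2)
qed

lemma admits_non_Cartan_symmetry_example: "admits_non_Cartan_symmetry 1 jet_domain example_rhs"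
proof -
  have "jet_domain \<noteq> {}"
    using second_order_system_example by (simp add: second_order_system_def)
  then have "non_Cartan 1 (trunc (1 + 1) ` jet_domain) example_xi"
    using pd_example(2) by (auto simp: non_Cartan_def)
  with symmetry_example show ?thesis
    unfolding admits_non_Cartan_symmetry_def by blast
qed

section \<open>The second derivative in transformed variables\<close>

lemma smooth_on_pd: "smooth_on n W f \<Longrightarrow> i < n \<Longrightarrow> smooth_on n W (pd i f)"
  using Ck_on.simps(2) unfolding smooth_on_def by blast

lemma smooth_on_has_pd:
  assumes "smooth_on n W f" "i < n" "z \<in> W"
  shows "((\<lambda>t. f (z(i := t))) has_field_derivative pd i f z) (at (z i))"
proof -
  have "Ck_on (Suc 0) n W f"
    using assms(1) by (simp only: smooth_on_def)
  then have "(\<lambda>t. f (z(i := t))) differentiable (at (z i))"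
    using assms(2,3) by simp
  then show ?thesis
    unfolding pd_def by (auto simp: real_differentiable_def DERIV_imp_deriv)
qed

lemma smooth_on_has_pd_trunc:
  assumes "smooth_on n W f" "trunc n z \<in> W"
  shows "((\<lambda>t. f (trunc n (z(i := t)))) has_field_derivative
    (if i < n then pd i f (trunc n z) else 0)) (at (z i))"
  using smooth_on_has_pd[OF assms(1) _ assms(2), of i]
  by (auto simp: trunc_fun_upd trunc_apply)

text \<open>With M = D X and N = D Y, the quotient rule gives D (N / M) / M = (M D N - N D M) / M^3.
  The mixed partials appear as a sum of both orders, just as the product rule delivers them.\<close>

lemma new_deriv2_1:
  fixes \<Phi> :: "(nat \<Rightarrow> real) \<Rightarrow> nat \<Rightarrow> real" and z :: "nat \<Rightarrow> real"
  defines "X \<equiv> \<lambda>b. \<Phi> b 0" and "Y \<equiv> \<lambda>b. \<Phi> b 1"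
    and "b \<equiv> trunc 2 z" and "p \<equiv> z 2" and "q \<equiv> z 3"
  defines "M \<equiv> pd 0 X b + p * pd 1 X b" and "N \<equiv> pd 0 Y b + p * pd 1 Y b"
  assumes smooth: "smooth_on 2 W X" "smooth_on 2 W Y" and b: "b \<in> W" and M: "M \<noteq> 0"
  shows "new_deriv1 1 \<Phi> 1 z = N / M"
    and "new_deriv2 1 \<Phi> 1 z =
      (M * (pd 0 (pd 0 Y) b + p * (pd 0 (pd 1 Y) b + pd 1 (pd 0 Y) b) + p ^ 2 * pd 1 (pd 1 Y) b
            + q * pd 1 Y b)
       - N * (pd 0 (pd 0 X) b + p * (pd 0 (pd 1 X) b + pd 1 (pd 0 X) b) + p ^ 2 * pd 1 (pd 1 X) b
            + q * pd 1 X b)) / M ^ 3"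
proof -
  have nd1: "new_deriv1 1 \<Phi> 1 =
      (\<lambda>z. (pd 0 Y (trunc 2 z) + z 2 * pd 1 Y (trunc 2 z)) /
           (pd 0 X (trunc 2 z) + z 2 * pd 1 X (trunc 2 z)))"
    unfolding new_deriv1_def[abs_def] total_deriv_lift_1 X_def Y_def by simp
  show "new_deriv1 1 \<Phi> 1 z = N / M"
    unfolding nd1 N_def M_def b_def p_def ..
  \<comment> \<open>\<open>d i f\<close> is the derivative of \<open>f\<close> composed with the
    projection to the base, hence 0 in the direction p; \<open>e i\<close> is the derivative of the
    coordinate p itself.\<close>
  define d where "d i f = (if i < 2 then pd i f b else 0)" for i f
  define e where "e i = (if i = (2::nat) then 1 else 0 :: real)" for i
  have D: "((\<lambda>t. f (trunc 2 (z(i := t)))) has_field_derivative d i f) (at (z i))"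
    if "smooth_on 2 W f" for f i
    unfolding d_def b_def by (rule smooth_on_has_pd_trunc[OF that b[unfolded b_def]])
  have D2: "((\<lambda>t. (z(i := t)) 2) has_field_derivative e i) (at (z i))" for i
    unfolding e_def by (rule has_field_derivative_fun_upd)
  have DN: "((\<lambda>t. pd 0 f (trunc 2 (z(i := t))) + (z(i := t)) 2 * pd 1 f (trunc 2 (z(i := t))))
      has_field_derivative d i (pd 0 f) + (e i * pd 1 f b + d i (pd 1 f) * p)) (at (z i))"
    if "smooth_on 2 W f" for f i
    using DERIV_add[OF D[OF smooth_on_pd] DERIV_mult[OF D2 D[OF smooth_on_pd]]] that
    by (auto simp: b_def p_def)
  have pd: "pd i (new_deriv1 1 \<Phi> 1) z =
     ((d i (pd 0 Y) + (e i * pd 1 Y b + d i (pd 1 Y) * p)) * M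
      - N * (d i (pd 0 X) + (e i * pd 1 X b + d i (pd 1 X) * p))) / (M * M)" for i
  proof (rule pd_eqI)
    show "((\<lambda>t. new_deriv1 1 \<Phi> 1 (z(i := t))) has_field_derivative
     ((d i (pd 0 Y) + (e i * pd 1 Y b + d i (pd 1 Y) * p)) * M
      - N * (d i (pd 0 X) + (e i * pd 1 X b + d i (pd 1 X) * p))) / (M * M)) (at (z i))"
      using DERIV_divide[OF DN[OF smooth(2)] DN[OF smooth(1)], of i] M
      unfolding nd1 M_def N_def b_def p_def by (simp del: fun_upd_apply)
  qed
  have "total_deriv 1 (lift 1 (\<lambda>b. \<Phi> b 0)) z = M"
    unfolding total_deriv_lift_1 M_def X_def b_def p_def ..
  then show "new_deriv2 1 \<Phi> 1 z =
      (M * (pd 0 (pd 0 Y) b + p * (pd 0 (pd 1 Y) b + pd 1 (pd 0 Y) b) + p ^ 2 * pd 1 (pd 1 Y) b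
            + q * pd 1 Y b)
       - N * (pd 0 (pd 0 X) b + p * (pd 0 (pd 1 X) b + pd 1 (pd 0 X) b) + p ^ 2 * pd 1 (pd 1 X) b
            + q * pd 1 X b)) / M ^ 3"
    unfolding new_deriv2_def total_deriv_1[of "new_deriv1 1 \<Phi> 1"] pd
    using M by (simp add: d_def e_def field_simps power2_eq_square power3_eq_cube flip: p_def q_def)
qed

section \<open>The trivial system as a linear system\<close>

lemma linear_system_zero:
  "1 \<le> m \<Longrightarrow> linear_system m (topspace (Euclidean_space (2 * m + 1))) (\<lambda>j z. 0)"
proof -
  assume "1 \<le> m"
  moreover have "(\<lambda>i. 0) \<in> topspace (Euclidean_space n)" for n
    by (simp add: topspace_Euclidean_space_iff)
  ultimately show ?thesis
    unfolding linear_system_def second_order_system_def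
    by (intro conjI exI[of _ UNIV] exI[of _ "\<lambda>_ _ _. 0"] exI[of _ "\<lambda>_ _. 0"])
       (auto simp: smooth_on_const simp del: null_topspace_iff_trivial)
qed

lemma reducible_to_trivial_imp_linearizable:
  "1 \<le> m \<Longrightarrow> reducible_to_trivial m \<Omega> F \<Longrightarrow> linearizable m \<Omega> F"
  unfolding reducible_to_trivial_def linearizable_def using linear_system_zero by blast

section \<open>The polynomial obstruction to linearizability\<close>

text \<open>A nonempty open set of reals is infinite, while a nonzero polynomial has finitely many
  roots.\<close>

lemma poly_eq_0_if_open:
  fixes P :: "real poly"
  assumes "open V" "a \<in> V" "\<And>x. x \<in> V \<Longrightarrow> poly P x = 0"
  shows "P = 0"
proof (rule ccontr)
  assume "P \<noteq> 0"
  then have "finite V"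
    using assms(3) by (auto intro: finite_subset[OF _ poly_roots_finite])
  then show False
    using infinite_openin[of UNIV V a] assms(1,2) by (simp add: islimpt_UNIV)
qed

text \<open>
  Along a line of directions \<open>p\<close> over a fixed base point, a linear equation pulls back to
  \<open>J q = P(p)\<close> with a constant \<open>J\<close> (the Jacobian of the transformation) and a polynomial \<open>P\<close>.
  No invertibility is used: if \<open>J\<close> vanished, the pulled back equation would not involve \<open>q\<close>,
  so it could not be equivalent to \<open>q = F\<close>.
\<close>

lemma linearizable_1_imp_polynomial:
  assumes "linearizable 1 \<Omega> F" "\<Omega> \<subseteq> topspace (Euclidean_space 3)"
  shows "\<exists>z V P J. open V \<and> z 2 \<in> V \<and> J \<noteq> 0 \<and>
    (\<forall>p\<in>V. z(2 := p) \<in> \<Omega> \<and> J * F 1 (z(2 := p)) = poly P p)"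
proof -
  have nums: "2 * 1 + 1 = (3 :: nat)" "3 * 1 + 1 = (4 :: nat)" "1 + 1 = (2 :: nat)"
    by simp_all
  obtain \<Omega>' G where lin: "linear_system 1 \<Omega>' G"
    and into: "point_transforms_into 1 \<Omega> F \<Omega>' G"
    using assms(1) unfolding linearizable_def by blast
  obtain W \<Phi> U where tr: "point_transformation 1 W \<Phi>"
    and U: "openin (Euclidean_space 3) U" "U \<noteq> {}" "U \<subseteq> \<Omega>" "trunc 2 ` U \<subseteq> W"
    and equiv: "\<forall>z\<in>topspace (Euclidean_space 4). trunc 3 z \<in> U \<longrightarrow>
       total_deriv 1 (lift 1 (\<lambda>b. \<Phi> b 0)) z \<noteq> 0 \<and>
       trunc 3 (prolong_map 1 \<Phi> z) \<in> \<Omega>' \<and>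
       (on_equation 1 \<Omega> F z \<longleftrightarrow> on_equation 1 \<Omega>' G (prolong_map 1 \<Phi> z))"
    using into unfolding point_transforms_into_def nums by (elim exE conjE) (rule that)
  note eqv = equiv[rule_format]
  obtain A B C where G: "\<And>z. z \<in> \<Omega>' \<Longrightarrow> G 1 z = A (z 0) * z 2 + B (z 0) * z 1 + C (z 0)"
    using lin unfolding linear_system_def by (force simp: numeral_2_eq_2)
  define X Y where "X = (\<lambda>b. \<Phi> b 0)" and "Y = (\<lambda>b. \<Phi> b 1)"
  have smooth: "smooth_on 2 W X" "smooth_on 2 W Y"
    using tr by (auto simp: point_transformation_def X_def Y_def numeral_2_eq_2)
  obtain z where z: "z \<in> U" using U(2) by blast
  have z3: "z \<in> topspace (Euclidean_space 3)" using z U assms(2) by blast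
  define b where "b = trunc 2 z"
  have b: "b \<in> W" using z U(4) by (auto simp: b_def)
  define V where "V = {p. z(2 := p) \<in> U}"
  have V: "open V" "z 2 \<in> V"
    using open_coordinate_line[OF U(1) z3] z by (auto simp: V_def)
  \<comment> \<open>The base point of \<open>z\<close> stays fixed from here on; only the direction
    p and the second derivative q vary.\<close>
  define jet where "jet p q = z(2 := p, 3 := q)" for p q
  have jet: "jet p q \<in> topspace (Euclidean_space 4)" "trunc 3 (jet p q) = z(2 := p)"
    "trunc 2 (jet p q) = b" "jet p q 2 = p" "jet p q 3 = q" for p q
    using z3 by (auto simp: jet_def b_def topspace_Euclidean_space_iff trunc_def fun_eq_iff)
  \<comment> \<open>Over the fixed base point, D X and D Y are polynomials in p; \<open>M2\<close>
    and \<open>N2\<close> are the parts of the second total derivatives of X and Y that are free of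
    q.\<close>
  define M N where "M = [:pd 0 X b, pd 1 X b:]" and "N = [:pd 0 Y b, pd 1 Y b:]"
  define M2 N2 where
    "M2 = [:pd 0 (pd 0 X) b, pd 0 (pd 1 X) b + pd 1 (pd 0 X) b, pd 1 (pd 1 X) b:]" and
    "N2 = [:pd 0 (pd 0 Y) b, pd 0 (pd 1 Y) b + pd 1 (pd 0 Y) b, pd 1 (pd 1 Y) b:]"
  define a e J where "a = A (X b)" and "e = B (X b) * Y b + C (X b)"
    and "J = pd 0 X b * pd 1 Y b - pd 0 Y b * pd 1 X b"
  \<comment> \<open>Found by multiplying the transformed equation Y'' = a (N / M) + e by M^3 and
    isolating the terms with q.\<close>
  define P where "P = smult a (M ^ 2 * N) + smult e (M ^ 3) - M * N2 + N * M2"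
  \<comment> \<open>D X does not involve q, so the jet with q = 0 suffices.\<close>
  have M0: "poly M p \<noteq> 0" if "p \<in> V" for p
  proof -
    have "total_deriv 1 (lift 1 (\<lambda>b. \<Phi> b 0)) (jet p 0) = poly M p"
      by (simp add: total_deriv_lift_1 jet M_def X_def flip: One_nat_def)
    with eqv[OF jet(1), of p 0] that show ?thesis
      by (simp add: jet V_def)
  qed
  \<comment> \<open>Over a fixed first order jet both equations become conditions on q alone, and
    they are equivalent for every real q.\<close>
  have on: "q = F 1 (z(2 := p)) \<longleftrightarrow> J * q = poly P p" if p: "p \<in> V" for p q
  proof -
    let ?w = "prolong_map 1 \<Phi> (jet p q)"
    have M0': "pd 0 X b + p * pd 1 X b \<noteq> 0"
      using M0[OF p] by (simp add: M_def)
    have b': "trunc 2 (jet p q) \<in> W"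
      using b jet by simp
    note nd = new_deriv2_1[of W \<Phi> "jet p q", folded X_def Y_def, OF smooth b', unfolded jet, OF M0']
    have w: "?w 0 = X b" "?w 1 = Y b" "?w 2 = poly N p / poly M p"
      "?w 3 = (poly M p * (poly N2 p + q * pd 1 Y b) - poly N p * (poly M2 p + q * pd 1 X b)) / poly M p ^ 3"
      using jet(3)[of p q] nd
      by (simp_all add: prolong_map_def X_def Y_def M_def N_def M2_def N2_def
          numeral_2_eq_2[symmetric] algebra_simps power2_eq_square)
    have U': "trunc 3 (jet p q) \<in> U"
      using p by (simp add: jet V_def)
    note eqv = eqv[OF jet(1) U']
    have "q = F 1 (z(2 := p)) \<longleftrightarrow> on_equation 1 \<Omega> F (jet p q)"
      using U' U(3) jet[of p q] by (auto simp: on_equation_def Delta_def numeral_3_eq_3[symmetric])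
    also have "\<dots> \<longleftrightarrow> ?w 3 = G 1 (trunc 3 ?w)"
    proof -
      have "?w \<in> topspace (Euclidean_space 4)"
        by (simp add: topspace_Euclidean_space_iff prolong_map_def)
      with eqv show ?thesis
        by (auto simp: on_equation_def Delta_def numeral_3_eq_3[symmetric])
    qed
    also have "\<dots> \<longleftrightarrow> ?w 3 = a * ?w 2 + e"
      using eqv by (simp add: G trunc_apply w a_def e_def add.assoc flip: One_nat_def)
    also have "\<dots> \<longleftrightarrow> J * q = poly P p"
    proof -
      \<comment> \<open>The terms linear in p cancel, so the coefficient of q is the Jacobian and is
        the same for all p.\<close>
      have "poly M p * pd 1 Y b - poly N p * pd 1 X b = J"
        by (simp add: M_def N_def J_def algebra_simps)
      then have "J * q = (poly M p * pd 1 Y b - poly N p * pd 1 X b) * q"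
        by simp
      then have "poly M p * (poly N2 p + q * pd 1 Y b) - poly N p * (poly M2 p + q * pd 1 X b)
          = J * q + poly M p * poly N2 p - poly N p * poly M2 p"
        by (simp add: algebra_simps)
      then have "?w 3 = a * ?w 2 + e \<longleftrightarrow> J * q + poly M p * poly N2 p - poly N p * poly M2 p
          = (a * (poly N p / poly M p) + e) * poly M p ^ 3"
        unfolding w using M0[OF p] by (simp add: divide_eq_eq)
      also have "(a * (poly N p / poly M p) + e) * poly M p ^ 3 =
          a * (poly M p ^ 2 * poly N p) + e * poly M p ^ 3"
        using M0[OF p] by (simp add: field_simps power2_eq_square power3_eq_cube)
      finally show ?thesis
        by (auto simp: P_def)
    qed
    finally show ?thesis .
  qed
  have "J \<noteq> 0"
  proof
    assume "J = 0"
    with on[OF V(2)] have "q = F 1 (z(2 := z 2)) \<longleftrightarrow> poly P (z 2) = 0" for q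
      by auto
    from this[of "F 1 (z(2 := z 2))"] this[of "F 1 (z(2 := z 2)) + 1"] show False
      by simp
  qed
  moreover have "\<forall>p\<in>V. z(2 := p) \<in> \<Omega> \<and> J * F 1 (z(2 := p)) = poly P p"
    using on U(3) by (auto simp: V_def)
  ultimately show ?thesis
    using V by blast
qed

lemma not_linearizable_example: "\<not> linearizable 1 jet_domain example_rhs"
proof
  assume "linearizable 1 jet_domain example_rhs"
  from linearizable_1_imp_polynomial[OF this]
  obtain z V P J where V: "open V" "z 2 \<in> V" and J: "J \<noteq> 0"
    and eq: "\<And>p. p \<in> V \<Longrightarrow> z(2 := p) \<in> jet_domain \<and> J * example_rhs 1 (z(2 := p)) = poly P p"
    by (auto simp: jet_domain_def)
  have "smult J ([:-1, 1:] ^ 4) - [:0, 1:] * P = 0"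
  proof (rule poly_eq_0_if_open[OF V])
    fix p assume "p \<in> V"
    from eq[OF this] show "poly (smult J ([:-1, 1:] ^ 4) - [:0, 1:] * P) p = 0"
      by (auto simp: example_rhs_def jet_domain_def field_simps)
  qed
  \<comment> \<open>The point 0 lies outside \<open>V\<close>, where p > 0; it can be inserted
    because the identity has been extended from \<open>V\<close> to an identity of
    polynomials.\<close>
  then have "poly (smult J ([:-1, 1:] ^ 4) - [:0, 1:] * P) 0 = 0"
    by simp
  with J show False by simp
qed

theorem mainTheorem4:
  shows "(\<exists>\<Omega> F. second_order_system 1 \<Omega> F \<and> \<not> linearizable 1 \<Omega> F \<and>
            admits_non_Cartan_symmetry 1 \<Omega> F) \<and>
         \<not> (\<forall>m \<Omega> F. second_order_system m \<Omega> F \<longrightarrow>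
              (admits_non_Cartan_symmetry m \<Omega> F \<longleftrightarrow> reducible_to_trivial m \<Omega> F))"
  using second_order_system_example not_linearizable_example admits_non_Cartan_symmetry_example
    reducible_to_trivial_imp_linearizable[of 1]
  by blast

end
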